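(* There exists a $1$-$\rho_{10}$-cocycle $c$ with $c(F_+)=\xi_{11}$. The cocycle $c$ is not a coboundary, and every other non-trivial $1$-$\rho_{10}$-cocycle is a linear combination of $c$ and some $1$-$\rho_{10}$-coboundary.
   Context: The Lie algebra $so(3,1)\cong sl(2,\mathbb{C})$ of the Lorentz group is considered through its complexification, which has basis $\{H_1,H_2,H_3,F_1,F_2,F_3\}$ and relations $[H_j,H_k]=i\epsilon_{jk\ell}H_\ell$, $[F_j,F_k]=-i\epsilon_{jk\ell}H_\ell$, $[F_j,H_k]=i\epsilon_{jk\ell}F_\ell$ (summation over $\ell$; $\epsilon_{jk\ell}$ is the Levi-Civita symbol). It carries the involution $*$ (conjugate-linear, $[X,Y]^*=[Y^*,X^*]$) making these six elements hermitian. The real Lie algebra $\mathfrak{g}=so(3,1)$ consists of the anti-hermitian elements $X^*=-X$, i.e. it is the real span of $iH_j,iF_j$. Put $H_\pm=H_1\pm iH_2$ and $F_\pm=F_1\pm iF_2$. Let $D_{10}=\mathrm{span}\{\xi_{\ell m}:\ \ell=1,2,3,\ldots,\ m=-\ell,-\ell+1,\ldots,\ell\}$ be the complex pre-Hilbert space (algebraic linear span) for which the $\xi_{\ell m}$ form an orthonormal system. For $\ell\ge 1$ set $C_\ell=i\sqrt{\frac{\ell^2-1}{4\ell^2-1}}$. The representation $\rho_{10}$ acts on $D_{10}$ by $$\rho_{10}(H_3)\xi_{\ell m}=m\,\xi_{\ell m},\qquad \rho_{10}(H_\pm)\xi_{\ell m}=\sqrt{(\ell\mp m)(\ell\pm m+1)}\,\xi_{\ell,m\pm1},$$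 $$\rho_{10}(F_3)\xi_{\ell m}=C_\ell\sqrt{\ell^2-m^2}\,\xi_{\ell-1,m}-C_{\ell+1}\sqrt{(\ell+1)^2-m^2}\,\xi_{\ell+1,m},$$ $$\rho_{10}(F_\pm)\xi_{\ell m}=\pm C_\ell\sqrt{(\ell\mp m)(\ell\mp m-1)}\,\xi_{\ell-1,m\pm1}\pm C_{\ell+1}\sqrt{(\ell\pm m+1)(\ell\pm m+2)}\,\xi_{\ell+1,m\pm1},$$ where terms with vanishing coefficient are omitted (in particular $C_1=0$). A $1$-$\rho$-cocycle, for a representation $\rho$ of $\mathfrak{g}$ on $D$, is a linear map $\eta:\mathfrak{g}\to D$ with $\eta([X,Y])=\rho(X)\eta(Y)-\rho(Y)\eta(X)$ for all $X,Y\in\mathfrak{g}$; it is extended complex-linearly to the complexification $\mathfrak{g}_{\mathbb{C}}$. A $1$-$\rho$-coboundary is a cocycle of the form $X\mapsto\rho(X)v$ for some fixed $v\in D$; a cocycle is non-trivial if it is not a coboundary. Linear combinations are over $\mathbb{C}$. *)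

theory Defs
  imports "HOL-Analysis.Analysis" "HOL-Library.Poly_Mapping" "HOL-Library.FuncSet"
begin

section \<open>The Lie algebra so(3,1) and its complexification\<close>

text \<open>The complexification is the complex vector space with basis \<open>H\<^sub>1, H\<^sub>2, H\<^sub>3, F\<^sub>1, F\<^sub>2, F\<^sub>3\<close>;
  its elements are the coordinate vectors with respect to this basis (\<open>IH j\<close>, \<open>IF j\<close> index
  the coordinates of \<open>H\<^sub>j\<close>, \<open>F\<^sub>j\<close>). In the index type \<open>3\<close>
  the numeral \<open>3\<close> is the same element as \<open>0\<close>, so \<open>1, 2, 3\<close> are its three elements.\<close>

datatype gen = IH 3 | IF 3

instance gen :: finite
proof
  have "(UNIV :: gen set) = range IH \<union> range IF"
    using gen.exhaust by blast
  then show "finite (UNIV :: gen set)"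
    by (metis finite_UnI finite_imageI finite)
qed

lemma sum_gen: "(\<Sum>a\<in>UNIV. f a) = (\<Sum>j\<in>UNIV. f (IH j)) + (\<Sum>j\<in>UNIV. f (IF j))"
  for f :: "gen \<Rightarrow> 'a::comm_monoid_add"
proof -
  have U: "(UNIV :: gen set) = range IH \<union> range IF"
    using gen.exhaust by blast
  have "(\<Sum>a\<in>UNIV. f a) = (\<Sum>a\<in>range IH. f a) + (\<Sum>a\<in>range IF. f a)"
    unfolding U by (rule sum.union_disjoint) auto
  then show ?thesis
    by (simp add: sum.reindex inj_def)
qed

type_synonym so31C = "complex ^ gen"

definition H :: "3 \<Rightarrow> so31C" where "H j = axis (IH j) 1"
definition F :: "3 \<Rightarrow> so31C" where "F j = axis (IF j) 1"

definition H_plus :: so31C where "H_plus = H 1 + \<i> *s H 2"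
definition H_minus :: so31C where "H_minus = H 1 - \<i> *s H 2"
definition F_plus :: so31C where "F_plus = F 1 + \<i> *s F 2"
definition F_minus :: so31C where "F_minus = F 1 - \<i> *s F 2"

definition levi_civita :: "3 \<Rightarrow> 3 \<Rightarrow> 3 \<Rightarrow> complex" where
  "levi_civita j k l =
     (if (j, k, l) \<in> {(1, 2, 3), (2, 3, 1), (3, 1, 2)} then 1
      else if (j, k, l) \<in> {(1, 3, 2), (3, 2, 1), (2, 1, 3)} then - 1
      else 0)"

fun bracket_gen :: "gen \<Rightarrow> gen \<Rightarrow> so31C" where
  "bracket_gen (IH j) (IH k) = (\<Sum>l\<in>UNIV. (\<i> * levi_civita j k l) *s H l)"
| "bracket_gen (IF j) (IF k) = (\<Sum>l\<in>UNIV. (- \<i> * levi_civita j k l) *s H l)"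
| "bracket_gen (IF j) (IH k) = (\<Sum>l\<in>UNIV. (\<i> * levi_civita j k l) *s F l)"
| "bracket_gen (IH j) (IF k) = - (\<Sum>l\<in>UNIV. (\<i> * levi_civita k j l) *s F l)"

definition bracket :: "so31C \<Rightarrow> so31C \<Rightarrow> so31C" where
  "bracket X Y = (\<Sum>a\<in>UNIV. \<Sum>b\<in>UNIV. (X $ a * Y $ b) *s bracket_gen a b)"

definition star :: "so31C \<Rightarrow> so31C" where
  "star X = (\<chi> a. cnj (X $ a))"

definition so31 :: "so31C set" where
  "so31 = {X. star X = - X}"

lemma cnj_levi_civita: "cnj (levi_civita j k l) = levi_civita j k l"
  by (simp add: levi_civita_def)

lemma levi_civita_swap: "levi_civita k j l = - levi_civita j k l"
proof -
  have "\<forall>j k l. levi_civita k j l = - levi_civita j k l"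
    by (simp add: forall_3 levi_civita_def)
  then show ?thesis by blast
qed

lemma bracket_gen_swap: "bracket_gen b a = - bracket_gen a b"
proof (cases a; cases b)
  fix j k
  assume "a = IH j" "b = IH k"
  then show ?thesis
    by (simp add: levi_civita_swap[of k j] sum_negf)
next
  fix j k
  assume "a = IH j" "b = IF k"
  then show ?thesis
    by (simp add: levi_civita_swap[of k j] sum_negf)
next
  fix j k
  assume "a = IF j" "b = IH k"
  then show ?thesis
    by (simp add: levi_civita_swap[of k j] sum_negf)
next
  fix j k
  assume "a = IF j" "b = IF k"
  then show ?thesis
    by (simp add: levi_civita_swap[of k j] sum_negf)
qed

lemma star_simps:
  "star (H j) = H j" "star (F j) = F j" "star (c *s X) = cnj c *s star X" "star (- X) = - star X"
  "star (\<Sum>a\<in>A. f a) = (\<Sum>a\<in>A. star (f a))"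
  by (simp_all add: star_def H_def F_def axis_def vec_eq_iff)

lemma star_bracket_gen: "star (bracket_gen a b) = bracket_gen b a"
proof -
  have "star (bracket_gen a b) = - bracket_gen a b"
    by (cases a; cases b) (simp_all add: star_simps cnj_levi_civita sum_negf)
  then show ?thesis
    by (simp add: bracket_gen_swap[of b a])
qed

lemma star_bracket: "star (bracket X Y) = bracket (star Y) (star X)"
proof -
  have "star (bracket X Y) = (\<Sum>a\<in>UNIV. \<Sum>b\<in>UNIV. (cnj (X $ a) * cnj (Y $ b)) *s star (bracket_gen a b))"
    by (simp add: bracket_def star_def vec_eq_iff)
  also have "\<dots> = bracket (star Y) (star X)"
    unfolding star_bracket_gen bracket_def
    by (subst sum.swap) (simp add: star_def mult.commute)
  finally show ?thesis .
qed

lemma bracket_so31: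
  assumes "X \<in> so31" "Y \<in> so31"
  shows "bracket X Y \<in> so31"
proof -
  have "star (bracket X Y) = bracket (- Y) (- X)"
    using assms by (simp add: star_bracket so31_def)
  also have "\<dots> = (\<Sum>a\<in>UNIV. \<Sum>b\<in>UNIV. (X $ b * Y $ a) *s - bracket_gen b a)"
    unfolding bracket_gen_swap[symmetric] by (simp add: bracket_def mult.commute)
  also have "\<dots> = - bracket X Y"
    by (subst sum.swap) (simp add: bracket_def sum_negf vec_eq_iff)
  finally show ?thesis by (simp add: so31_def)
qed

section \<open>The space \<open>D\<^sub>1\<^sub>0\<close>\<close>

text \<open>Finitely supported complex families indexed by all pairs \<open>(l, m)\<close>; \<open>D10\<close> is the span of the
  unit vectors with \<open>l \<ge> 1\<close> and \<open>\<bar>m\<bar> \<le> l\<close>.\<close>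

type_synonym lmspace = "nat \<times> int \<Rightarrow>\<^sub>0 complex"

definition cscale :: "complex \<Rightarrow> lmspace \<Rightarrow> lmspace" where
  "cscale c v = Poly_Mapping.map (\<lambda>x. c * x) v"

lemma lookup_cscale [simp]:
  "Poly_Mapping.lookup (cscale c v) p = c * Poly_Mapping.lookup v p"
  by (simp add: cscale_def Poly_Mapping.map.rep_eq when_def)

interpretation lmspace: vector_space cscale
  by unfold_locales (auto intro!: poly_mapping_eqI simp: lookup_add algebra_simps)

definition xi :: "nat \<Rightarrow> int \<Rightarrow> lmspace" where
  "xi l m = Poly_Mapping.single (l, m) 1"

definition D10 :: "lmspace set" where
  "D10 = lmspace.span {xi l m | l m. 1 \<le> l \<and> \<bar>m\<bar> \<le> int l}"

text \<open>The inner product making the \<open>xi l m\<close> orthonormal, conjugate-linear in its first argument.\<close>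

definition inner10 :: "lmspace \<Rightarrow> lmspace \<Rightarrow> complex" where
  "inner10 v w = (\<Sum>p\<in>Poly_Mapping.keys v. cnj (Poly_Mapping.lookup v p) * Poly_Mapping.lookup w p)"

lemma inner10_xi: "inner10 (xi l m) (xi l' m') = (if l = l' \<and> m = m' then 1 else 0)"
  by (auto simp: inner10_def xi_def lookup_single when_def)

section \<open>The representation \<open>\<rho>\<^sub>1\<^sub>0\<close>\<close>

definition lin_ext :: "(nat \<Rightarrow> int \<Rightarrow> lmspace) \<Rightarrow> lmspace \<Rightarrow> lmspace" where
  "lin_ext A v = (\<Sum>(l, m)\<in>Poly_Mapping.keys v. cscale (Poly_Mapping.lookup v (l, m)) (A l m))"

lemma lin_ext_xi: "lin_ext A (xi l m) = A l m"
  by (simp add: lin_ext_def xi_def)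

definition C10 :: "nat \<Rightarrow> complex" where
  "C10 l = \<i> * complex_of_real (sqrt ((real l ^ 2 - 1) / (4 * real l ^ 2 - 1)))"

text \<open>For \<open>l \<ge> 1\<close> and \<open>\<bar>m\<bar> \<le> l\<close>, whenever an index pair on the right-hand side is not admissible
  its coefficient is zero, so on \<open>D10\<close> the operators below take values in \<open>D10\<close>.\<close>

definition rho10_H3 :: "lmspace \<Rightarrow> lmspace" where
  "rho10_H3 = lin_ext (\<lambda>l m. cscale (of_int m) (xi l m))"

definition rho10_Hp :: "lmspace \<Rightarrow> lmspace" where
  "rho10_Hp = lin_ext (\<lambda>l m.
     cscale (complex_of_real (sqrt ((real l - of_int m) * (real l + of_int m + 1)))) (xi l (m + 1)))"

definition rho10_Hm :: "lmspace \<Rightarrow> lmspace" where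
  "rho10_Hm = lin_ext (\<lambda>l m.
     cscale (complex_of_real (sqrt ((real l + of_int m) * (real l - of_int m + 1)))) (xi l (m - 1)))"

definition rho10_F3 :: "lmspace \<Rightarrow> lmspace" where
  "rho10_F3 = lin_ext (\<lambda>l m.
     cscale (C10 l * complex_of_real (sqrt (real l ^ 2 - of_int m ^ 2))) (xi (l - 1) m)
   - cscale (C10 (l + 1) * complex_of_real (sqrt ((real l + 1) ^ 2 - of_int m ^ 2))) (xi (l + 1) m))"

definition rho10_Fp :: "lmspace \<Rightarrow> lmspace" where
  "rho10_Fp = lin_ext (\<lambda>l m.
     cscale (C10 l * complex_of_real (sqrt ((real l - of_int m) * (real l - of_int m - 1))))
       (xi (l - 1) (m + 1))
   + cscale (C10 (l + 1) * complex_of_real (sqrt ((real l + of_int m + 1) * (real l + of_int m + 2))))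
       (xi (l + 1) (m + 1)))"

definition rho10_Fm :: "lmspace \<Rightarrow> lmspace" where
  "rho10_Fm = lin_ext (\<lambda>l m.
   - cscale (C10 l * complex_of_real (sqrt ((real l + of_int m) * (real l + of_int m - 1))))
       (xi (l - 1) (m - 1))
   - cscale (C10 (l + 1) * complex_of_real (sqrt ((real l - of_int m + 1) * (real l - of_int m + 2))))
       (xi (l + 1) (m - 1)))"

text \<open>\<open>H\<^sub>1 = (H\<^sub>+ + H\<^sub>-) / 2\<close> and \<open>H\<^sub>2 = (H\<^sub>+ - H\<^sub>-) / (2 \<i>)\<close>, and likewise for \<open>F\<^sub>1, F\<^sub>2\<close>.\<close>

fun rho10_gen :: "gen \<Rightarrow> lmspace \<Rightarrow> lmspace" where
  "rho10_gen (IH j) v =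
     (if j = 1 then cscale (1 / 2) (rho10_Hp v + rho10_Hm v)
      else if j = 2 then cscale (1 / (2 * \<i>)) (rho10_Hp v - rho10_Hm v)
      else rho10_H3 v)"
| "rho10_gen (IF j) v =
     (if j = 1 then cscale (1 / 2) (rho10_Fp v + rho10_Fm v)
      else if j = 2 then cscale (1 / (2 * \<i>)) (rho10_Fp v - rho10_Fm v)
      else rho10_F3 v)"

definition rho10 :: "so31C \<Rightarrow> lmspace \<Rightarrow> lmspace" where
  "rho10 X v = (\<Sum>a\<in>UNIV. cscale (X $ a) (rho10_gen a v))"

lemma cscale_half:
  "cscale (1 / 2) (u + w) + cscale (1 / 2) (u - w) = u"
  "cscale (1 / 2) (u + w) - cscale (1 / 2) (u - w) = w"
  by (rule poly_mapping_eqI, simp only: lookup_add lookup_minus lookup_cscale, simp add: field_simps)+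

lemma rho10_H_plus: "rho10 H_plus v = rho10_Hp v"
  and rho10_H_minus: "rho10 H_minus v = rho10_Hm v"
  and rho10_H_3: "rho10 (H 3) v = rho10_H3 v"
  and rho10_F_plus: "rho10 F_plus v = rho10_Fp v"
  and rho10_F_minus: "rho10 F_minus v = rho10_Fm v"
  and rho10_F_3: "rho10 (F 3) v = rho10_F3 v"
  by (simp_all add: rho10_def sum_gen sum_3 H_plus_def H_minus_def F_plus_def F_minus_def
      H_def F_def axis_def cscale_half)

section \<open>Cocycles\<close>

text \<open>A map on the real Lie algebra is an extensional function on \<open>so31\<close>, so that equality of
  such maps is equality of functions.\<close>

definition is_cocycle :: "lmspace set \<Rightarrow> (so31C \<Rightarrow> lmspace \<Rightarrow> lmspace) \<Rightarrow> (so31C \<Rightarrow> lmspace) \<Rightarrow> bool"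
  where "is_cocycle D \<rho> \<eta> \<longleftrightarrow>
     \<eta> \<in> so31 \<rightarrow>\<^sub>E D \<and>
     (\<forall>X\<in>so31. \<forall>Y\<in>so31. \<eta> (X + Y) = \<eta> X + \<eta> Y) \<and>
     (\<forall>r::real. \<forall>X\<in>so31. \<eta> (r *\<^sub>R X) = cscale (complex_of_real r) (\<eta> X)) \<and>
     (\<forall>X\<in>so31. \<forall>Y\<in>so31. \<eta> (bracket X Y) = \<rho> X (\<eta> Y) - \<rho> Y (\<eta> X))"

definition is_coboundary ::
    "lmspace set \<Rightarrow> (so31C \<Rightarrow> lmspace \<Rightarrow> lmspace) \<Rightarrow> (so31C \<Rightarrow> lmspace) \<Rightarrow> bool"
  where "is_coboundary D \<rho> \<eta> \<longleftrightarrow> is_cocycle D \<rho> \<eta> \<and> (\<exists>v\<in>D. \<forall>X\<in>so31. \<eta> X = \<rho> X v)"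

text \<open>Every \<open>X\<close> is \<open>A + \<i> B\<close> for the anti-hermitian elements \<open>A = (X - X\<^sup>*) / 2\<close> and
  \<open>B = - \<i> (X + X\<^sup>*) / 2\<close>; this is the complex-linear extension of a real-linear map.\<close>

definition cext :: "(so31C \<Rightarrow> lmspace) \<Rightarrow> so31C \<Rightarrow> lmspace" where
  "cext \<eta> X = \<eta> ((1 / 2) *s (X - star X)) + cscale \<i> (\<eta> ((- \<i> / 2) *s (X + star X)))"

lemma cext_so31:
  assumes "is_cocycle D \<rho> \<eta>" "X \<in> so31"
  shows "cext \<eta> X = \<eta> X"
proof -
  have X: "star X = - X"
    using assms(2) by (simp add: so31_def)
  have "(1 / 2) *s (X - star X) = X" "(- \<i> / 2) *s (X + star X) = 0"
    by (simp_all add: X vec_eq_iff)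
  moreover have "\<eta> (0 *\<^sub>R X) = 0"
    using assms by (simp add: is_cocycle_def del: scaleR_zero_left)
  ultimately show ?thesis
    by (simp add: cext_def)
qed

lemma cext_add:
  assumes "is_cocycle D \<rho> \<eta>"
  shows "cext \<eta> (X + Y) = cext \<eta> X + cext \<eta> Y"
proof -
  have re: "(1 / 2) *s (Z - star Z) \<in> so31" and im: "(- \<i> / 2) *s (Z + star Z) \<in> so31" for Z
    by (simp_all add: so31_def star_def vec_eq_iff field_simps)
  have "(1 / 2) *s (X + Y - star (X + Y)) = (1 / 2) *s (X - star X) + (1 / 2) *s (Y - star Y)"
    "(- \<i> / 2) *s (X + Y + star (X + Y)) = (- \<i> / 2) *s (X + star X) + (- \<i> / 2) *s (Y + star Y)"
    by (simp_all add: star_def vec_eq_iff field_simps)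
  moreover have "\<eta> (U + V) = \<eta> U + \<eta> V" if "U \<in> so31" "V \<in> so31" for U V
    using assms that by (simp add: is_cocycle_def)
  ultimately show ?thesis
    by (simp only: cext_def re im lmspace.scale_right_distrib add.assoc add.left_commute)
qed

lemma cext_scale:
  assumes "is_cocycle D \<rho> \<eta>"
  shows "cext \<eta> (z *s X) = cscale z (cext \<eta> X)"
proof -
  define A where "A = (1 / 2) *s (X - star X)"
  define B where "B = (- \<i> / 2) *s (X + star X)"
  have AB: "A \<in> so31" "B \<in> so31"
    by (simp_all add: A_def B_def so31_def star_def vec_eq_iff field_simps)
  have sc: "r *\<^sub>R Z \<in> so31" if "Z \<in> so31" for r Z
    using that by (simp add: so31_def star_def vec_eq_iff)
  have add: "\<eta> (U + V) = \<eta> U + \<eta> V" if "U \<in> so31" "V \<in> so31" for U V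
    using assms that by (simp add: is_cocycle_def)
  have hom: "\<eta> (r *\<^sub>R Z) = cscale (complex_of_real r) (\<eta> Z)" if "Z \<in> so31" for r Z
    using assms that by (simp add: is_cocycle_def)
  have 1: "(1 / 2) *s (z *s X - star (z *s X)) = Re z *\<^sub>R A + (- Im z) *\<^sub>R B"
    and 2: "(- \<i> / 2) *s (z *s X + star (z *s X)) = Re z *\<^sub>R B + Im z *\<^sub>R A"
    by (simp_all add: A_def B_def star_def vec_eq_iff complex_eq_iff field_simps)
  have "cext \<eta> (z *s X) = cscale (Re z) (\<eta> A) - cscale (Im z) (\<eta> B)
      + cscale \<i> (cscale (Re z) (\<eta> B) + cscale (Im z) (\<eta> A))"
    unfolding cext_def 1 2 by (simp add: add hom sc AB del: scaleR_minus_left)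
  also have "\<dots> = cscale (Re z + \<i> * Im z) (\<eta> A + cscale \<i> (\<eta> B))"
    by (auto intro!: poly_mapping_eqI simp: lookup_add lookup_minus algebra_simps)
  also have "\<dots> = cscale z (cext \<eta> X)"
    by (simp add: cext_def A_def B_def complex_eq[symmetric] del: vector_smult_lneg)
  finally show ?thesis .
qed

end

theory Submission
  imports Defs
begin

text \<open>
  As a module over the rotation algebra spanned by the \<open>H\<^sub>j\<close>, \<open>D10\<close> is the direct sum of the
  irreducible modules of spin \<open>l = 1, 2, 3, \<dots>\<close>, each occurring once and none of them trivial.
  Everything follows from this decomposition.

  First, the restriction of any cocycle \<open>\<eta>\<close> to the rotation algebra is a coboundary
  (\<open>so3_cocycle_trivial\<close>). The Casimir operator \<open>H\<^sup>2\<close> acts on spin \<open>l\<close> by \<open>l (l + 1) \<noteq> 0\<close>, hence is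
  invertible and commutes with the \<open>H\<^sub>j\<close>; moreover the cocycle identity gives
  \<open>H\<^sub>j (\<Sum>\<^sub>k H\<^sub>k \<eta>(H\<^sub>k)) = H\<^sup>2 \<eta>(H\<^sub>j)\<close>. So \<open>\<eta>(H\<^sub>j) = H\<^sub>j v\<close> for
  \<open>v = (H\<^sup>2)\<^sup>-\<^sup>1 (\<Sum>\<^sub>k H\<^sub>k \<eta>(H\<^sub>k))\<close>.

  Next, subtract the coboundary of this \<open>v\<close>. What remains vanishes on the \<open>H\<^sub>j\<close>, so that its values on
  the \<open>F\<^sub>j\<close> form a vector operator. In particular its value at \<open>F\<^sub>+\<close> has weight \<open>1\<close> and is killed by
  \<open>H\<^sub>+\<close>: it is a highest weight vector of spin \<open>1\<close>, that is, a multiple of \<open>xi 1 1\<close>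
  (\<open>highest_weight_one\<close>, \<open>cocycle_normal_form\<close>). The values at \<open>F\<^sub>3\<close> and \<open>F\<^sub>-\<close> are obtained from the
  one at \<open>F\<^sub>+\<close> by applying \<open>H\<^sub>-\<close>, so there is at most one cocycle up to multiples and coboundaries
  (\<open>cocycle_is_coboundary\<close>).

  This one exists: let \<open>c\<close> vanish on the \<open>H\<^sub>j\<close> and identify the span of the \<open>F\<^sub>j\<close> equivariantly with
  the spin \<open>1\<close> part of \<open>D10\<close>. The only remaining condition is \<open>\<rho>(F\<^sub>j) c(F\<^sub>k) = \<rho>(F\<^sub>k) c(F\<^sub>j)\<close>
  (\<open>c10_gen_symmetric\<close>). The difference of the two sides is an antisymmetric tensor, hence of spin
  \<open>1\<close>, while \<open>\<rho>(F\<^sub>j)\<close> maps spin \<open>1\<close> into spin \<open>2\<close> because \<open>C\<^sub>1 = 0\<close>; so both sides agree.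
  Finally, a vector \<open>v\<close> with coboundary \<open>c\<close> would be annihilated by the \<open>H\<^sub>j\<close>, hence be \<open>0\<close>
  (\<open>no_invariants\<close>), contradicting \<open>c(F\<^sub>+) = xi 1 1\<close>.
\<close>

section \<open>Linear operators on the span of the weight vectors\<close>

abbreviation lin :: "(lmspace \<Rightarrow> lmspace) \<Rightarrow> bool" where
  "lin \<equiv> Vector_Spaces.linear cscale cscale"

interpretation lmspace_pair: vector_space_pair cscale cscale ..

lemma lookup_sum: "Poly_Mapping.lookup (sum f A) p = (\<Sum>a\<in>A. Poly_Mapping.lookup (f a) p)"
  by (induction A rule: infinite_finite_induct) (simp_all add: lookup_add)

lemma linI:
  assumes "\<And>u v. A (u + v) = A u + A v" "\<And>r v. A (cscale r v) = cscale r (A v)"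
  shows "lin A"
  by (simp add: Vector_Spaces.linear_def module_hom_def module_hom_axioms_def assms
      lmspace.module_axioms lmspace.vector_space_axioms)

text \<open>The sum defining \<open>lin_ext A v\<close> runs over a set that depends on \<open>v\<close>; a common larger index set is
  what makes additivity visible.\<close>

lemma lin_ext_superset:
  assumes "finite S" "Poly_Mapping.keys v \<subseteq> S"
  shows "lin_ext A v = (\<Sum>(l, m)\<in>S. cscale (Poly_Mapping.lookup v (l, m)) (A l m))"
  unfolding lin_ext_def using assms
  by (intro sum.mono_neutral_left) (auto simp: in_keys_iff)

lemma lin_lin_ext: "lin (lin_ext A)"
proof (rule linI)
  fix u v :: lmspace and r :: complex
  let ?S = "Poly_Mapping.keys u \<union> Poly_Mapping.keys v"
  have "Poly_Mapping.keys (u + v) \<subseteq> ?S"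
    by (rule keys_add)
  then show "lin_ext A (u + v) = lin_ext A u + lin_ext A v"
    by (simp add: lin_ext_superset[of ?S] sum.distrib[symmetric] lookup_add
        lmspace.scale_left_distrib split_def)
  have "Poly_Mapping.keys (cscale r v) \<subseteq> Poly_Mapping.keys v"
    by (auto simp: in_keys_iff)
  then show "lin_ext A (cscale r v) = cscale r (lin_ext A v)"
    by (simp add: lin_ext_superset[of "Poly_Mapping.keys v"] lmspace.scale_sum_right split_def)
qed

lemma lin_rho10_gens:
  "lin rho10_H3" "lin rho10_Hp" "lin rho10_Hm" "lin rho10_F3" "lin rho10_Fp" "lin rho10_Fm"
  unfolding rho10_H3_def rho10_Hp_def rho10_Hm_def rho10_F3_def rho10_Fp_def rho10_Fm_def
  by (rule lin_lin_ext)+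

lemmas rho10_linear [simp] =
  lin_rho10_gens[THEN lmspace_pair.linear_add] lin_rho10_gens[THEN lmspace_pair.linear_diff]
  lin_rho10_gens[THEN lmspace_pair.linear_neg]
  lin_rho10_gens[THEN lmspace_pair.linear_scale] lin_rho10_gens[THEN lmspace_pair.linear_0]

lemma rho10_gen_linear:
  "rho10_gen a (u + v) = rho10_gen a u + rho10_gen a v"
  "rho10_gen a (cscale r v) = cscale r (rho10_gen a v)"
  by (cases a; auto intro!: poly_mapping_eqI simp: lookup_add lookup_minus algebra_simps)+

lemma lin_rho10: "lin (rho10 X)"
  by (rule linI) (simp_all add: rho10_def rho10_gen_linear sum.distrib lmspace.scale_right_distrib
      lmspace.scale_sum_right mult.commute)

lemma rho10_add: "rho10 (X + Y) v = rho10 X v + rho10 Y v"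
  by (simp add: rho10_def lmspace.scale_left_distrib sum.distrib)

lemma rho10_smult: "rho10 (z *s X) v = cscale z (rho10 X v)"
  by (simp add: rho10_def lmspace.scale_sum_right)

lemma D10_induct [consumes 1, case_names basis zero add scale]:
  assumes "v \<in> D10"
    and "\<And>l m. 1 \<le> l \<Longrightarrow> \<bar>m\<bar> \<le> int l \<Longrightarrow> P (xi l m)"
    and "P 0" "\<And>u w. P u \<Longrightarrow> P w \<Longrightarrow> P (u + w)" "\<And>r u. P u \<Longrightarrow> P (cscale r u)"
  shows "P v"
proof -
  have "lmspace.subspace {u. P u}"
    using assms(3-5) by (simp add: lmspace.subspace_def)
  then have "D10 \<subseteq> {u. P u}"
    unfolding D10_def by (intro lmspace.span_minimal) (auto simp: assms(2))
  with assms(1) show ?thesis by blast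
qed

lemma lookup_xi: "Poly_Mapping.lookup (xi l m) p = (if p = (l, m) then 1 else 0)"
  by (simp add: xi_def lookup_single when_def)

lemma xi_in_D10: "1 \<le> l \<Longrightarrow> \<bar>m\<bar> \<le> int l \<Longrightarrow> xi l m \<in> D10"
  unfolding D10_def by (rule lmspace.span_base) auto

lemma D10_closed:
  "0 \<in> D10" "u \<in> D10 \<Longrightarrow> v \<in> D10 \<Longrightarrow> u + v \<in> D10" "u \<in> D10 \<Longrightarrow> v \<in> D10 \<Longrightarrow> u - v \<in> D10"
  "v \<in> D10 \<Longrightarrow> cscale r v \<in> D10" "v \<in> D10 \<Longrightarrow> - v \<in> D10"
  unfolding D10_def
  by (auto intro: lmspace.span_zero lmspace.span_add lmspace.span_diff lmspace.span_scale
      lmspace.span_neg)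

section \<open>Commutation relations\<close>

lemma rho10_H3_xi: "rho10_H3 (xi l m) = cscale (of_int m) (xi l m)"
  by (simp add: rho10_H3_def lin_ext_xi)

lemma rho10_Hp_xi: "rho10_Hp (xi l m) =
    cscale (complex_of_real (sqrt ((real l - of_int m) * (real l + of_int m + 1)))) (xi l (m + 1))"
  by (simp add: rho10_Hp_def lin_ext_xi)

lemma rho10_Hm_xi: "rho10_Hm (xi l m) =
    cscale (complex_of_real (sqrt ((real l + of_int m) * (real l - of_int m + 1)))) (xi l (m - 1))"
  by (simp add: rho10_Hm_def lin_ext_xi)

lemma rho10_F3_xi: "rho10_F3 (xi l m) =
     cscale (C10 l * complex_of_real (sqrt (real l ^ 2 - of_int m ^ 2))) (xi (l - 1) m)
   - cscale (C10 (l + 1) * complex_of_real (sqrt ((real l + 1) ^ 2 - of_int m ^ 2))) (xi (l + 1) m)"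
  by (simp add: rho10_F3_def lin_ext_xi)

lemma rho10_Fp_xi: "rho10_Fp (xi l m) =
     cscale (C10 l * complex_of_real (sqrt ((real l - of_int m) * (real l - of_int m - 1))))
       (xi (l - 1) (m + 1))
   + cscale (C10 (l + 1) * complex_of_real (sqrt ((real l + of_int m + 1) * (real l + of_int m + 2))))
       (xi (l + 1) (m + 1))"
  by (simp add: rho10_Fp_def lin_ext_xi)

lemma rho10_Fm_xi: "rho10_Fm (xi l m) =
   - cscale (C10 l * complex_of_real (sqrt ((real l + of_int m) * (real l + of_int m - 1))))
       (xi (l - 1) (m - 1))
   - cscale (C10 (l + 1) * complex_of_real (sqrt ((real l - of_int m + 1) * (real l - of_int m + 2))))
       (xi (l + 1) (m - 1))"
  by (simp add: rho10_Fm_def lin_ext_xi)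

lemmas rho10_xi = rho10_H3_xi rho10_Hp_xi rho10_Hm_xi rho10_F3_xi rho10_Fp_xi rho10_Fm_xi

lemma H_preserves_D10:
  assumes "v \<in> D10"
  shows "rho10_H3 v \<in> D10" "rho10_Hp v \<in> D10" "rho10_Hm v \<in> D10"
proof -
  show "rho10_H3 v \<in> D10"
    using assms by (induction rule: D10_induct) (simp_all add: D10_closed rho10_H3_xi xi_in_D10)
  have "rho10_Hp (xi l m) \<in> D10" if "1 \<le> l" "\<bar>m\<bar> \<le> int l" for l m
    using that by (cases "m = int l") (auto simp: rho10_Hp_xi intro!: D10_closed xi_in_D10)
  with assms show "rho10_Hp v \<in> D10"
    by (induction rule: D10_induct) (simp_all add: D10_closed)
  have "rho10_Hm (xi l m) \<in> D10" if "1 \<le> l" "\<bar>m\<bar> \<le> int l" for l m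
    using that by (cases "m = - int l") (auto simp: rho10_Hm_xi intro!: D10_closed xi_in_D10)
  with assms show "rho10_Hm v \<in> D10"
    by (induction rule: D10_induct) (simp_all add: D10_closed)
qed

abbreviation rt :: "real \<Rightarrow> complex" where
  "rt x \<equiv> complex_of_real (sqrt x)"

text \<open>In the coordinates \<open>d = l - m\<close> and \<open>e = l + m\<close> the coefficients are, apart from the factors
  \<open>C10\<close>, those of quadratic expressions in the ladder operators of two harmonic oscillators with occupation numbers \<open>d\<close> and \<open>e\<close>. Splitting
  every square root into its two factors, which is possible for arguments of any sign because
  \<open>sqrt\<close> is odd, reduces the commutation relations to products of single roots.\<close>

lemma rho10_xi_factored:
  assumes "d = real l - of_int m" "e = real l + of_int m"
  shows "rho10_Hp (xi l m) = cscale (rt d * rt (e + 1)) (xi l (m + 1))"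
    and "rho10_Hm (xi l m) = cscale (rt e * rt (d + 1)) (xi l (m - 1))"
    and "rho10_F3 (xi l m) = cscale (C10 l * (rt d * rt e)) (xi (l - 1) m)
      - cscale (C10 (l + 1) * (rt (d + 1) * rt (e + 1))) (xi (l + 1) m)"
    and "rho10_Fp (xi l m) = cscale (C10 l * (rt d * rt (d - 1))) (xi (l - 1) (m + 1))
      + cscale (C10 (l + 1) * (rt (e + 1) * rt (e + 2))) (xi (l + 1) (m + 1))"
    and "rho10_Fm (xi l m) = - cscale (C10 l * (rt e * rt (e - 1))) (xi (l - 1) (m - 1))
      - cscale (C10 (l + 1) * (rt (d + 1) * rt (d + 2))) (xi (l + 1) (m - 1))"
proof -
  have eqs: "d * (e + 1) = (real l - of_int m) * (real l + of_int m + 1)"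
    "e * (d + 1) = (real l + of_int m) * (real l - of_int m + 1)"
    "d * e = real l ^ 2 - of_int m ^ 2"
    "(d + 1) * (e + 1) = (real l + 1) ^ 2 - of_int m ^ 2"
    "d * (d - 1) = (real l - of_int m) * (real l - of_int m - 1)"
    "(e + 1) * (e + 2) = (real l + of_int m + 1) * (real l + of_int m + 2)"
    "e * (e - 1) = (real l + of_int m) * (real l + of_int m - 1)"
    "(d + 1) * (d + 2) = (real l - of_int m + 1) * (real l - of_int m + 2)"
    unfolding assms by (simp_all add: algebra_simps power2_eq_square)
  show "rho10_Hp (xi l m) = cscale (rt d * rt (e + 1)) (xi l (m + 1))"
    "rho10_Hm (xi l m) = cscale (rt e * rt (d + 1)) (xi l (m - 1))"
    "rho10_F3 (xi l m) = cscale (C10 l * (rt d * rt e)) (xi (l - 1) m)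
      - cscale (C10 (l + 1) * (rt (d + 1) * rt (e + 1))) (xi (l + 1) m)"
    "rho10_Fp (xi l m) = cscale (C10 l * (rt d * rt (d - 1))) (xi (l - 1) (m + 1))
      + cscale (C10 (l + 1) * (rt (e + 1) * rt (e + 2))) (xi (l + 1) (m + 1))"
    "rho10_Fm (xi l m) = - cscale (C10 l * (rt e * rt (e - 1))) (xi (l - 1) (m - 1))
      - cscale (C10 (l + 1) * (rt (d + 1) * rt (d + 2))) (xi (l + 1) (m - 1))"
    unfolding of_real_mult[symmetric] real_sqrt_mult[symmetric] eqs rho10_xi by (rule refl)+
qed

text \<open>For integral \<open>x \<ge> 0\<close> the argument \<open>x - 1\<close> is negative only for \<open>x = 0\<close>, where the factor
  \<open>rt x\<close> vanishes.\<close>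

lemma rt_square:
  fixes k :: int
  assumes "0 \<le> k" "x = of_int k"
  shows "rt x * rt x = of_real x" "rt (x + 1) * rt (x + 1) = of_real x + 1"
    "rt (x + 2) * rt (x + 2) = of_real x + 2" "rt x * (rt (x - 1) * rt (x - 1)) = rt x * (of_real x - 1)"
proof -
  have sq: "rt y * rt y = of_real y" if "y \<ge> 0" for y
    using that by (simp flip: of_real_mult)
  from assms have "x \<ge> 0" and x: "x = 0 \<or> x \<ge> 1"
    by (simp_all, linarith)
  show "rt x * rt x = of_real x" "rt (x + 1) * rt (x + 1) = of_real x + 1"
    "rt (x + 2) * rt (x + 2) = of_real x + 2"
    using sq[of x] sq[of "x + 1"] sq[of "x + 2"] \<open>x \<ge> 0\<close> by simp_all
  show "rt x * (rt (x - 1) * rt (x - 1)) = rt x * (of_real x - 1)"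
    using x sq[of "x - 1"] by auto
qed

text \<open>In the commutators below, \<open>[X, Y] = Z\<close> is written as \<open>X Y = Y X + Z\<close>, so that it can be used
  to move \<open>X\<close> past \<open>Y\<close>. The relations involving an \<open>F\<close> say that \<open>F\<^sub>+\<close> is a highest weight vector of
  weight \<open>1\<close> for the rotations, and that \<open>F\<^sub>3\<close> and \<open>F\<^sub>-\<close> are obtained from it by lowering.\<close>

lemma comm_Hp_Hm:
  assumes "v \<in> D10"
  shows "rho10_Hp (rho10_Hm v) = rho10_Hm (rho10_Hp v) + cscale 2 (rho10_H3 v)"
  using assms
proof (induction rule: D10_induct)
  case (basis l m)
  define d e where de: "d = real l - of_int m" "e = real l + of_int m"
  have nonneg: "0 \<le> int l - m" "0 \<le> int l + m"
    and de': "d = of_int (int l - m)" "e = of_int (int l + m)"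
    using basis by (simp_all add: de)
  note sq = rt_square[OF nonneg(1) de'(1)] rt_square[OF nonneg(2) de'(2)]
  have "rho10_Hp (rho10_Hm (xi l m)) = cscale ((rt e * rt e) * (rt (d + 1) * rt (d + 1))) (xi l m)"
    using rho10_xi_factored(2)[OF de] rho10_xi_factored(1)[of "d + 1" l "m - 1" "e - 1"]
    by (simp add: de mult_ac)
  moreover have "rho10_Hm (rho10_Hp (xi l m)) = cscale ((rt d * rt d) * (rt (e + 1) * rt (e + 1))) (xi l m)"
    using rho10_xi_factored(1)[OF de] rho10_xi_factored(2)[of "d - 1" l "m + 1" "e + 1"]
    by (simp add: de mult_ac)
  moreover have "rt e * rt e * (rt (d + 1) * rt (d + 1)) = rt d * rt d * (rt (e + 1) * rt (e + 1)) + 2 * of_int m"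
    unfolding sq by (simp add: de algebra_simps)
  ultimately show ?case
    by (simp add: rho10_H3_xi lmspace.scale_left_distrib)
qed (simp_all add: lmspace.scale_right_distrib mult.commute algebra_simps)

lemma comm_H3_Hp:
  assumes "v \<in> D10"
  shows "rho10_H3 (rho10_Hp v) = rho10_Hp (rho10_H3 v) + rho10_Hp v"
  using assms
  by (induction rule: D10_induct)
    (simp_all add: rho10_H3_xi rho10_Hp_xi lmspace.scale_right_distrib lmspace.scale_left_distrib mult.commute)

lemma comm_H3_Hm:
  assumes "v \<in> D10"
  shows "rho10_H3 (rho10_Hm v) = rho10_Hm (rho10_H3 v) - rho10_Hm v"
  using assms
  by (induction rule: D10_induct)
    (simp_all add: rho10_H3_xi rho10_Hm_xi lmspace.scale_right_diff_distrib lmspace.scale_left_diff_distrib mult.commute)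

lemma comm_H3_Fp:
  assumes "v \<in> D10"
  shows "rho10_H3 (rho10_Fp v) = rho10_Fp (rho10_H3 v) + rho10_Fp v"
  using assms
  by (induction rule: D10_induct)
    (simp_all add: rho10_H3_xi rho10_Fp_xi lmspace.scale_right_distrib lmspace.scale_left_distrib mult.commute)

lemma comm_Hp_Fp:
  assumes "v \<in> D10"
  shows "rho10_Hp (rho10_Fp v) = rho10_Fp (rho10_Hp v)"
  using assms
proof (induction rule: D10_induct)
  case (basis l m)
  define d e where de: "d = real l - of_int m" "e = real l + of_int m"
  have "rho10_Hp (rho10_Fp (xi l m)) =
      cscale (C10 l * (rt d * rt (d - 1) * rt (d - 2) * rt (e + 1))) (xi (l - 1) (m + 2))
    + cscale (C10 (l + 1) * (rt d * rt (e + 1) * rt (e + 2) * rt (e + 3))) (xi (l + 1) (m + 2))"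
    using rho10_xi_factored(4)[OF de] rho10_xi_factored(1)[of "d - 2" "l - 1" "m + 1" e]
      rho10_xi_factored(1)[of d "l + 1" "m + 1" "e + 2"] basis
    by (simp add: de mult_ac add_ac)
  moreover have "rho10_Fp (rho10_Hp (xi l m)) =
      cscale (C10 l * (rt d * rt (d - 1) * rt (d - 2) * rt (e + 1))) (xi (l - 1) (m + 2))
    + cscale (C10 (l + 1) * (rt d * rt (e + 1) * rt (e + 2) * rt (e + 3))) (xi (l + 1) (m + 2))"
    using rho10_xi_factored(1)[OF de] rho10_xi_factored(4)[of "d - 1" l "m + 1" "e + 1"]
    by (simp add: de mult_ac add_ac lmspace.scale_right_distrib)
  ultimately show ?case by simp
qed (simp_all add: lmspace.scale_right_distrib)

lemma comm_Fp_Hm: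
  assumes "v \<in> D10"
  shows "rho10_Fp (rho10_Hm v) = rho10_Hm (rho10_Fp v) + cscale 2 (rho10_F3 v)"
  using assms
proof (induction rule: D10_induct)
  case (basis l m)
  define d e where de: "d = real l - of_int m" "e = real l + of_int m"
  have nonneg: "0 \<le> int l - m" "0 \<le> int l + m"
    and de': "d = of_int (int l - m)" "e = of_int (int l + m)"
    using basis by (simp_all add: de)
  note sq = rt_square[OF nonneg(1) de'(1)] rt_square[OF nonneg(2) de'(2)]
  have lhs: "rho10_Fp (rho10_Hm (xi l m)) =
      cscale (C10 l * (rt d * (rt (d + 1) * rt (d + 1)) * rt e)) (xi (l - 1) m)
    + cscale (C10 (l + 1) * (rt (d + 1) * (rt e * rt e) * rt (e + 1))) (xi (l + 1) m)"
    using rho10_xi_factored(2)[OF de] rho10_xi_factored(4)[of "d + 1" l "m - 1" "e - 1"]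
    by (simp add: de mult_ac lmspace.scale_right_distrib)
  have rhs: "rho10_Hm (rho10_Fp (xi l m)) =
      cscale (C10 l * (rt d * (rt (d - 1) * rt (d - 1)) * rt e)) (xi (l - 1) m)
    + cscale (C10 (l + 1) * (rt (d + 1) * (rt (e + 2) * rt (e + 2)) * rt (e + 1))) (xi (l + 1) m)"
    using rho10_xi_factored(4)[OF de] rho10_xi_factored(2)[of "d - 2" "l - 1" "m + 1" e]
      rho10_xi_factored(2)[of d "l + 1" "m + 1" "e + 2"] basis
    by (simp add: de mult_ac add_ac)
  show ?case
    unfolding lhs rhs rho10_xi_factored(3)[OF de] sq
    by (rule poly_mapping_eqI) (simp add: lookup_add lookup_minus algebra_simps)
qed (simp_all add: lmspace.scale_right_distrib mult.commute algebra_simps)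

lemma comm_F3_Hm:
  assumes "v \<in> D10"
  shows "rho10_F3 (rho10_Hm v) = rho10_Hm (rho10_F3 v) - rho10_Fm v"
  using assms
proof (induction rule: D10_induct)
  case (basis l m)
  define d e where de: "d = real l - of_int m" "e = real l + of_int m"
  have nonneg: "0 \<le> int l - m" "0 \<le> int l + m"
    and de': "d = of_int (int l - m)" "e = of_int (int l + m)"
    using basis by (simp_all add: de)
  note sq = rt_square[OF nonneg(1) de'(1)] rt_square[OF nonneg(2) de'(2)]
  have lhs: "rho10_F3 (rho10_Hm (xi l m)) =
      cscale (C10 l * (rt e * rt (e - 1) * (rt (d + 1) * rt (d + 1)))) (xi (l - 1) (m - 1))
    - cscale (C10 (l + 1) * (rt (d + 1) * rt (d + 2) * (rt e * rt e))) (xi (l + 1) (m - 1))"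
    using rho10_xi_factored(2)[OF de] rho10_xi_factored(3)[of "d + 1" l "m - 1" "e - 1"]
    by (simp add: de mult_ac add_ac lmspace.scale_right_diff_distrib)
  have rhs: "rho10_Hm (rho10_F3 (xi l m)) =
      cscale (C10 l * (rt e * rt (e - 1) * (rt d * rt d))) (xi (l - 1) (m - 1))
    - cscale (C10 (l + 1) * (rt (d + 1) * rt (d + 2) * (rt (e + 1) * rt (e + 1)))) (xi (l + 1) (m - 1))"
    using rho10_xi_factored(3)[OF de] rho10_xi_factored(2)[of "d - 1" "l - 1" m "e - 1"]
      rho10_xi_factored(2)[of "d + 1" "l + 1" m "e + 1"] basis
    by (simp add: de mult_ac add_ac)
  show ?case
    unfolding lhs rhs rho10_xi_factored(5)[OF de] sq
    by (rule poly_mapping_eqI) (simp add: lookup_add lookup_minus algebra_simps)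
qed (simp_all add: lmspace.scale_right_diff_distrib add_diff_add)

section \<open>The Casimir operator of the rotation algebra\<close>

text \<open>Operators acting by a scalar on each spin; they commute with the rotations.\<close>

definition scale_level :: "(nat \<Rightarrow> complex) \<Rightarrow> lmspace \<Rightarrow> lmspace" where
  "scale_level g = lin_ext (\<lambda>l m. cscale (g l) (xi l m))"

lemma scale_level_xi: "scale_level g (xi l m) = cscale (g l) (xi l m)"
  by (simp add: scale_level_def lin_ext_xi)

lemma lin_scale_level: "lin (scale_level g)"
  unfolding scale_level_def by (rule lin_lin_ext)

lemmas scale_level_linear [simp] =
  lin_scale_level[THEN lmspace_pair.linear_add]
  lin_scale_level[THEN lmspace_pair.linear_scale] lin_scale_level[THEN lmspace_pair.linear_0]

lemma scale_level_H:
  assumes "v \<in> D10"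
  shows "rho10_H3 (scale_level g v) = scale_level g (rho10_H3 v)"
    "rho10_Hp (scale_level g v) = scale_level g (rho10_Hp v)"
    "rho10_Hm (scale_level g v) = scale_level g (rho10_Hm v)"
  using assms
  by (induction rule: D10_induct)
    (simp_all add: scale_level_xi rho10_H3_xi rho10_Hp_xi rho10_Hm_xi mult.commute)

lemma scale_level_in_D10:
  assumes "v \<in> D10"
  shows "scale_level g v \<in> D10"
  using assms by (induction rule: D10_induct) (simp_all add: scale_level_xi D10_closed xi_in_D10)

text \<open>The operator \<open>H\<^sub>1\<^sup>2 + H\<^sub>2\<^sup>2 + H\<^sub>3\<^sup>2\<close>, in ladder form.\<close>

definition casimir :: "lmspace \<Rightarrow> lmspace" where
  "casimir v = rho10_Hm (rho10_Hp v) + rho10_H3 (rho10_H3 v) + rho10_H3 v"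

lemma casimir_linear [simp]:
  "casimir 0 = 0" "casimir (u + v) = casimir u + casimir v" "casimir (cscale r v) = cscale r (casimir v)"
  by (simp_all add: casimir_def lmspace.scale_right_distrib add_ac)

text \<open>The Casimir operator acts on spin \<open>l\<close> by \<open>l (l + 1)\<close>, which is invertible as \<open>l \<ge> 1\<close> on
  \<open>D10\<close>.\<close>

lemma casimir_inverse:
  assumes "v \<in> D10"
  shows "scale_level (\<lambda>l. 1 / (of_nat l * (of_nat l + 1))) (casimir v) = v"
  using assms
proof (induction rule: D10_induct)
  case (basis l m)
  define d e where de: "d = real l - of_int m" "e = real l + of_int m"
  have nonneg: "0 \<le> int l - m" "0 \<le> int l + m"
    and de': "d = of_int (int l - m)" "e = of_int (int l + m)"
    using basis by (simp_all add: de)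
  note sq = rt_square[OF nonneg(1) de'(1)] rt_square[OF nonneg(2) de'(2)]
  have "rho10_Hm (rho10_Hp (xi l m)) = cscale ((rt d * rt d) * (rt (e + 1) * rt (e + 1))) (xi l m)"
    using rho10_xi_factored(1)[OF de] rho10_xi_factored(2)[of "d - 1" l "m + 1" "e + 1"]
    by (simp add: de mult_ac)
  also have "\<dots> = cscale (of_real d * (of_real e + 1)) (xi l m)"
    unfolding sq by simp
  finally have "casimir (xi l m) = cscale (of_nat l * (of_nat l + 1)) (xi l m)"
    unfolding casimir_def
    by (simp add: de rho10_H3_xi lmspace.scale_left_distrib[symmetric] algebra_simps
        del: lmspace.scale_left_distrib)
  moreover have "of_nat l * (of_nat l + 1) \<noteq> (0 :: complex)"
    using basis(1) by (simp add: of_nat_Suc[symmetric] add.commute del: of_nat_Suc)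
  ultimately show ?case
    by (simp add: scale_level_xi)
qed simp_all

text \<open>Whitehead's argument: the hypotheses are the cocycle identities for the brackets \<open>[H\<^sub>3, H\<^sub>+]\<close>,
  \<open>[H\<^sub>3, H\<^sub>-]\<close> and \<open>[H\<^sub>+, H\<^sub>-]\<close>, and \<open>v\<close> is the inverse Casimir operator applied to
  \<open>w = \<Sum>\<^sub>k H\<^sub>k \<eta>(H\<^sub>k)\<close>.\<close>

lemma so3_cocycle_trivial:
  assumes D: "e3 \<in> D10" "ep \<in> D10" "em \<in> D10"
    and p: "ep = rho10_H3 ep - rho10_Hp e3"
    and m: "- em = rho10_H3 em - rho10_Hm e3"
    and pm: "cscale 2 e3 = rho10_Hp em - rho10_Hm ep"
  shows "\<exists>v\<in>D10. rho10_H3 v = e3 \<and> rho10_Hp v = ep \<and> rho10_Hm v = em"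
proof -
  \<comment> \<open>This is \<open>(H\<^sub>+ em + H\<^sub>- ep) / 2 + H\<^sub>3 e3\<close>, with \<open>H\<^sub>+ em\<close> eliminated by the third identity.\<close>
  define w where "w = rho10_Hm ep + rho10_H3 e3 + e3"
  have w: "w \<in> D10"
    unfolding w_def by (intro D10_closed H_preserves_D10 D)
  define v where "v = scale_level (\<lambda>l. 1 / (of_nat l * (of_nat l + 1))) w"
  have double: "cscale 2 u = u + u" for u
    using lmspace.scale_left_distrib[of 1 1 u] by simp
  have Hp: "rho10_Hp e3 = rho10_H3 ep - ep" and Hm: "rho10_Hm e3 = rho10_H3 em + em"
    and Hpm: "rho10_Hm ep = rho10_Hp em - (e3 + e3)"
    using p m pm unfolding double by (simp_all add: algebra_simps)
  have "rho10_H3 w = casimir e3"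
    unfolding w_def casimir_def by (simp add: comm_H3_Hm D Hp)
  moreover have "rho10_Hp w = casimir ep"
  proof -
    have "rho10_Hp (rho10_H3 e3) = rho10_H3 (rho10_Hp e3) - rho10_Hp e3"
      by (simp add: comm_H3_Hp D)
    then show ?thesis
      unfolding w_def casimir_def by (simp add: comm_Hp_Hm D Hp double)
  qed
  moreover have "rho10_Hm w = casimir em"
  proof -
    have "rho10_Hm (rho10_H3 e3) = rho10_H3 (rho10_Hm e3) + rho10_Hm e3"
      by (simp add: comm_H3_Hm D)
    then show ?thesis
      unfolding w_def casimir_def Hpm by (simp add: Hm)
  qed
  ultimately have "rho10_H3 v = e3" "rho10_Hp v = ep" "rho10_Hm v = em"
    unfolding v_def by (simp_all add: scale_level_H w casimir_inverse D)
  moreover have "v \<in> D10"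
    unfolding v_def by (rule scale_level_in_D10[OF w])
  ultimately show ?thesis by blast
qed

section \<open>Highest weight vectors\<close>

text \<open>The formulas for coordinates below are proved on the whole space, because they are applied to
  vectors such as \<open>rho10_Fp v\<close>, whose coordinates need not be controlled otherwise.\<close>

lemma lmspace_induct [case_names basis zero add scale]:
  assumes "\<And>l m. P (xi l m)"
    and "P 0" "\<And>u w. P u \<Longrightarrow> P w \<Longrightarrow> P (u + w)" "\<And>r u. P u \<Longrightarrow> P (cscale r u)"
  shows "P v"
proof -
  have P_sum: "P (\<Sum>(l, m)\<in>S. cscale (Poly_Mapping.lookup v (l, m)) (xi l m))" for S
    by (induction S rule: infinite_finite_induct) (auto intro: assms)
  have expansion: "(\<Sum>(l, m)\<in>Poly_Mapping.keys v. cscale (Poly_Mapping.lookup v (l, m)) (xi l m)) = v"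
  proof (rule poly_mapping_eqI)
    fix p
    have "Poly_Mapping.lookup (case q of (l, m) \<Rightarrow> cscale (Poly_Mapping.lookup v (l, m)) (xi l m)) p =
        (if q = p then Poly_Mapping.lookup v q else 0)" for q
      by (cases q) (auto simp: lookup_xi)
    then show "Poly_Mapping.lookup (\<Sum>(l, m)\<in>Poly_Mapping.keys v.
        cscale (Poly_Mapping.lookup v (l, m)) (xi l m)) p = Poly_Mapping.lookup v p"
      by (simp add: lookup_sum in_keys_iff)
  qed
  from P_sum[of "Poly_Mapping.keys v"] show ?thesis
    unfolding expansion .
qed

lemma lookup_H3: "Poly_Mapping.lookup (rho10_H3 v) (l, m) = of_int m * Poly_Mapping.lookup v (l, m)"
proof (induction v rule: lmspace_induct)
  case (basis l' m')
  show ?case by (auto simp: rho10_H3_xi lookup_xi)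
next
  case (add u w)
  then show ?case by (simp only: rho10_linear lookup_add distrib_left)
next
  case (scale r u)
  then show ?case by (simp only: rho10_linear lookup_cscale mult.left_commute)
qed simp

lemma lookup_Hp: "Poly_Mapping.lookup (rho10_Hp v) (l, m + 1) =
    rt ((real l - of_int m) * (real l + of_int m + 1)) * Poly_Mapping.lookup v (l, m)"
proof (induction v rule: lmspace_induct)
  case (basis l' m')
  show ?case by (auto simp: rho10_Hp_xi lookup_xi)
next
  case (add u w)
  then show ?case by (simp only: rho10_linear lookup_add distrib_left)
next
  case (scale r u)
  then show ?case by (simp only: rho10_linear lookup_cscale mult.left_commute)
qed simp

text \<open>Only weight \<open>1\<close> can occur in \<open>u\<close>, and \<open>H\<^sub>+\<close> multiplies the coordinate of \<open>xi l 1\<close> by the square root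
  of \<open>(l - 1) (l + 2)\<close>, which vanishes for \<open>l = 1\<close> alone.\<close>

lemma highest_weight_one:
  assumes "rho10_H3 u = u" "rho10_Hp u = 0"
  shows "u = cscale (Poly_Mapping.lookup u (1, 1)) (xi 1 1)"
proof (rule poly_mapping_eqI, clarify)
  fix l :: nat and m :: int
  have "of_int m * Poly_Mapping.lookup u (l, m) = Poly_Mapping.lookup u (l, m)"
    using lookup_H3[of u l m] assms(1) by simp
  moreover have "rt ((real l - 1) * (real l + 2)) * Poly_Mapping.lookup u (l, 1) = 0"
    using lookup_Hp[of u l 1] assms(2) by simp
  ultimately show "Poly_Mapping.lookup u (l, m) =
      Poly_Mapping.lookup (cscale (Poly_Mapping.lookup u (1, 1)) (xi 1 1)) (l, m)"
    by (cases "m = 1") (auto simp: lookup_xi)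
qed

lemma lookup_level_0: "v \<in> D10 \<Longrightarrow> Poly_Mapping.lookup v (0, m) = 0"
  by (induction rule: D10_induct) (simp_all add: lookup_xi lookup_add)

text \<open>An invariant vector has weight \<open>0\<close>, and \<open>H\<^sub>+\<close> multiplies the coordinate of \<open>xi l 0\<close> by the square
  root of \<open>l (l + 1)\<close>; so it lies in spin \<open>0\<close>, which \<open>D10\<close> does not contain.\<close>

lemma no_invariants:
  assumes "v \<in> D10" "rho10_H3 v = 0" "rho10_Hp v = 0"
  shows "v = 0"
proof (rule poly_mapping_eqI, clarify)
  fix l :: nat and m :: int
  have "of_int m * Poly_Mapping.lookup v (l, m) = 0"
    using lookup_H3[of v l m] assms(2) by simp
  moreover have "rt (real l * (real l + 1)) * Poly_Mapping.lookup v (l, 0) = 0"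
    using lookup_Hp[of v l 0] assms(3) by simp
  ultimately show "Poly_Mapping.lookup v (l, m) = Poly_Mapping.lookup 0 (l, m)"
    using lookup_level_0[OF assms(1)] by (cases "m = 0"; cases "l = 0") auto
qed

section \<open>Complex-linear extension\<close>

lemma bracket_add_left: "bracket (X + Y) Z = bracket X Z + bracket Y Z"
  and bracket_add_right: "bracket Z (X + Y) = bracket Z X + bracket Z Y"
  and bracket_smult_left: "bracket (z *s X) Y = z *s bracket X Y"
  and bracket_smult_right: "bracket X (z *s Y) = z *s bracket X Y"
  by (simp_all add: bracket_def vec_eq_iff sum.distrib[symmetric] sum_distrib_left algebra_simps)

lemmas bracket_bilinear = bracket_add_left bracket_add_right bracket_smult_left bracket_smult_right

lemma bracket_axis: "bracket (axis a 1) (axis b 1) = bracket_gen a b"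
proof -
  have "(axis a 1 $ a' * axis b 1 $ b') *s bracket_gen a' b' =
      (if b' = b then if a' = a then bracket_gen a b else 0 else 0)" for a' b'
    by (simp add: axis_def)
  then show ?thesis
    by (simp add: bracket_def)
qed

lemma so31C_decompose:
  obtains A B where "A \<in> so31" "B \<in> so31" "X = A + \<i> *s B"
proof
  show "(1 / 2) *s (X - star X) \<in> so31" "(- \<i> / 2) *s (X + star X) \<in> so31"
    by (simp_all add: so31_def star_def vec_eq_iff field_simps)
  show "X = (1 / 2) *s (X - star X) + \<i> *s ((- \<i> / 2) *s (X + star X))"
    by (simp add: vec_eq_iff field_simps)
qed

lemmas rho10_lin [simp] = lin_rho10[THEN lmspace_pair.linear_add]
  lin_rho10[THEN lmspace_pair.linear_scale] lin_rho10[THEN lmspace_pair.linear_0]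

text \<open>Both sides are complex-bilinear and agree for \<open>X\<close>, \<open>Y\<close> in the real form.\<close>

lemma cext_bracket:
  assumes "is_cocycle D10 rho10 \<eta>"
  shows "cext \<eta> (bracket X Y) = rho10 X (cext \<eta> Y) - rho10 Y (cext \<eta> X)"
proof -
  obtain A B where X: "A \<in> so31" "B \<in> so31" "X = A + \<i> *s B" by (rule so31C_decompose)
  obtain C D where Y: "C \<in> so31" "D \<in> so31" "Y = C + \<i> *s D" by (rule so31C_decompose)
  note ext = cext_add[OF assms] cext_scale[OF assms]
  have real: "cext \<eta> (bracket U V) = rho10 U (cext \<eta> V) - rho10 V (cext \<eta> U)"
    if "U \<in> so31" "V \<in> so31" for U V
    using assms that by (simp add: cext_so31 bracket_so31) (simp add: is_cocycle_def)
  show ?thesis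
    unfolding X(3) Y(3) bracket_bilinear ext rho10_add rho10_smult rho10_lin
      real[OF X(1) Y(1)] real[OF X(1) Y(2)] real[OF X(2) Y(1)] real[OF X(2) Y(2)]
    by (rule poly_mapping_eqI) (simp add: lookup_add lookup_minus algebra_simps)
qed

lemma ladder_brackets:
  "bracket (H 3) H_plus = H_plus" "bracket (H 3) H_minus = - H_minus"
  "bracket H_plus H_minus = 2 *s H 3" "bracket (H 3) F_plus = F_plus"
  "bracket H_plus F_plus = 0" "bracket F_plus H_minus = 2 *s F 3"
  "bracket (F 3) H_minus = - F_minus"
proof -
  have HH: "bracket (H j) (H k) = bracket_gen (IH j) (IH k)"
    and HF: "bracket (H j) (F k) = bracket_gen (IH j) (IF k)"
    and FH: "bracket (F j) (H k) = bracket_gen (IF j) (IH k)" for j k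
    unfolding H_def F_def by (rule bracket_axis)+
  have minus: "U - V = U + (-1) *s V" for U V :: so31C
    by (simp add: vec_eq_iff)
  show "bracket (H 3) H_plus = H_plus" "bracket (H 3) H_minus = - H_minus"
    "bracket H_plus H_minus = 2 *s H 3" "bracket (H 3) F_plus = F_plus"
    "bracket H_plus F_plus = 0" "bracket F_plus H_minus = 2 *s F 3"
    "bracket (F 3) H_minus = - F_minus"
    unfolding H_plus_def H_minus_def F_plus_def F_minus_def minus bracket_bilinear HH HF FH
    by (simp_all add: sum_3 levi_civita_def vec_eq_iff algebra_simps)
qed

lemma so31C_ladder_expansion:
  "X = (X $ IH 3) *s H 3
     + ((X $ IH 1 - \<i> * X $ IH 2) / 2) *s H_plus + ((X $ IH 1 + \<i> * X $ IH 2) / 2) *s H_minus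
     + (X $ IF 3) *s F 3
     + ((X $ IF 1 - \<i> * X $ IF 2) / 2) *s F_plus + ((X $ IF 1 + \<i> * X $ IF 2) / 2) *s F_minus"
  (is "X = ?Y")
proof -
  have "\<forall>j. X $ IH j = ?Y $ IH j" "\<forall>j. X $ IF j = ?Y $ IF j"
    unfolding forall_3
    by (simp_all add: H_plus_def H_minus_def F_plus_def F_minus_def H_def F_def axis_def field_simps)
  then show ?thesis
    unfolding vec_eq_iff by (metis gen.exhaust)
qed

section \<open>Cocycles up to coboundaries\<close>

lemma cext_minus:
  assumes "is_cocycle D \<rho> \<eta>"
  shows "cext \<eta> (- X) = - cext \<eta> X"
proof -
  have "- X = (-1) *s X"
    by (simp add: vec_eq_iff)
  then show ?thesis
    by (simp only: cext_scale[OF assms] lmspace.scale_minus_left lmspace.scale_one)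
qed

text \<open>A cocycle is determined by its values on the \<open>H\<^sub>j\<close> and at \<open>F\<^sub>+\<close>, since \<open>[F\<^sub>+, H\<^sub>-] = 2 F\<^sub>3\<close> and
  \<open>[F\<^sub>3, H\<^sub>-] = - F\<^sub>-\<close>. The same brackets hold for the operators of the representation, so the
  comparison with \<open>X \<mapsto> rho10 X v\<close> can be made for \<open>F\<^sub>3\<close> and then for \<open>F\<^sub>-\<close>.\<close>

lemma cocycle_is_coboundary:
  assumes \<eta>: "is_cocycle D10 rho10 \<eta>" and v: "v \<in> D10"
    and H: "cext \<eta> (H 3) = rho10_H3 v" "cext \<eta> H_plus = rho10_Hp v" "cext \<eta> H_minus = rho10_Hm v"
    and Fp: "cext \<eta> F_plus = rho10_Fp v"
  shows "is_coboundary D10 rho10 \<eta>"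
proof -
  note ext = cext_add[OF \<eta>] cext_scale[OF \<eta>] cext_minus[OF \<eta>]
  have "cscale 2 (cext \<eta> (F 3)) = cscale 2 (rho10_F3 v)"
    using cext_bracket[OF \<eta>, of F_plus H_minus]
    by (simp add: ladder_brackets ext rho10_F_plus rho10_H_minus H Fp comm_Fp_Hm v)
  then have F3: "cext \<eta> (F 3) = rho10_F3 v"
    by simp
  have Fm: "cext \<eta> F_minus = rho10_Fm v"
    using cext_bracket[OF \<eta>, of "F 3" H_minus]
    by (simp add: ladder_brackets ext rho10_F_3 rho10_H_minus H F3 comm_F3_Hm v)
  have "\<eta> X = rho10 X v" if "X \<in> so31" for X
  proof -
    have "cext \<eta> X = rho10 X v"
      by (subst (1 2) so31C_ladder_expansion[of X])
        (simp only: ext rho10_add rho10_smult H F3 Fp Fm rho10_H_plus rho10_H_minus rho10_H_3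
          rho10_F_plus rho10_F_minus rho10_F_3)
    then show ?thesis
      by (simp add: cext_so31[OF \<eta> that])
  qed
  with \<eta> v show ?thesis
    unfolding is_coboundary_def by blast
qed

text \<open>The vector \<open>v\<close> trivialises the restriction to the rotation algebra; the brackets \<open>[H\<^sub>3, F\<^sub>+] = F\<^sub>+\<close>
  and \<open>[H\<^sub>+, F\<^sub>+] = 0\<close> then make the deviation at \<open>F\<^sub>+\<close> a highest weight vector of weight \<open>1\<close>.\<close>

lemma cocycle_normal_form:
  assumes \<eta>: "is_cocycle D10 rho10 \<eta>"
  obtains v a where "v \<in> D10" "cext \<eta> (H 3) = rho10_H3 v" "cext \<eta> H_plus = rho10_Hp v"
    "cext \<eta> H_minus = rho10_Hm v" "cext \<eta> F_plus = rho10_Fp v + cscale a (xi 1 1)"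
proof -
  note ext = cext_add[OF \<eta>] cext_scale[OF \<eta>] cext_minus[OF \<eta>]
  have D: "cext \<eta> X \<in> D10" for X
  proof -
    have "\<eta> Y \<in> D10" if "Y \<in> so31" for Y
      using \<eta> that by (auto simp: is_cocycle_def)
    moreover obtain A B where "A \<in> so31" "B \<in> so31" "X = A + \<i> *s B" by (rule so31C_decompose)
    ultimately show ?thesis
      by (simp add: ext cext_so31[OF \<eta>] D10_closed)
  qed
  have "\<exists>v\<in>D10. rho10_H3 v = cext \<eta> (H 3) \<and> rho10_Hp v = cext \<eta> H_plus \<and> rho10_Hm v = cext \<eta> H_minus"
  proof (rule so3_cocycle_trivial[OF D D D])
    show "cext \<eta> H_plus = rho10_H3 (cext \<eta> H_plus) - rho10_Hp (cext \<eta> (H 3))"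
      using cext_bracket[OF \<eta>, of "H 3" H_plus]
      by (simp add: ladder_brackets rho10_H_3 rho10_H_plus)
    show "- cext \<eta> H_minus = rho10_H3 (cext \<eta> H_minus) - rho10_Hm (cext \<eta> (H 3))"
      using cext_bracket[OF \<eta>, of "H 3" H_minus]
      by (simp add: ladder_brackets rho10_H_3 rho10_H_minus ext)
    show "cscale 2 (cext \<eta> (H 3)) = rho10_Hp (cext \<eta> H_minus) - rho10_Hm (cext \<eta> H_plus)"
      using cext_bracket[OF \<eta>, of H_plus H_minus]
      by (simp add: ladder_brackets rho10_H_plus rho10_H_minus ext)
  qed
  then obtain v where v: "v \<in> D10" and H: "cext \<eta> (H 3) = rho10_H3 v"
    "cext \<eta> H_plus = rho10_Hp v" "cext \<eta> H_minus = rho10_Hm v"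
    by metis
  define u where "u = cext \<eta> F_plus - rho10_Fp v"
  have "cext \<eta> F_plus = rho10_H3 (cext \<eta> F_plus) - rho10_Fp (rho10_H3 v)"
    using cext_bracket[OF \<eta>, of "H 3" F_plus]
    by (simp add: ladder_brackets rho10_H_3 rho10_F_plus H)
  then have "rho10_H3 u = u"
    by (simp add: u_def comm_H3_Fp v algebra_simps)
  moreover have "cext \<eta> 0 = 0"
    using ext(2)[of 0 0] by simp
  then have "rho10_Hp u = 0"
    using cext_bracket[OF \<eta>, of H_plus F_plus]
    by (simp add: ladder_brackets rho10_H_plus rho10_F_plus H u_def comm_Hp_Fp v)
  ultimately have "cext \<eta> F_plus = rho10_Fp v + cscale (Poly_Mapping.lookup u (1, 1)) (xi 1 1)"
    using highest_weight_one[of u] by (simp add: u_def algebra_simps)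
  with v H show thesis by (rule that)
qed

section \<open>The non-trivial cocycle\<close>

definition gen_ext :: "(gen \<Rightarrow> lmspace) \<Rightarrow> so31C \<Rightarrow> lmspace" where
  "gen_ext g X = (\<Sum>a\<in>UNIV. cscale (X $ a) (g a))"

lemma gen_ext_add: "gen_ext g (X + Y) = gen_ext g X + gen_ext g Y"
  by (simp add: gen_ext_def lmspace.scale_left_distrib sum.distrib)

lemma gen_ext_smult: "gen_ext g (z *s X) = cscale z (gen_ext g X)"
  by (simp add: gen_ext_def lmspace.scale_sum_right)

lemma gen_ext_minus: "gen_ext g (- X) = - gen_ext g X"
  by (simp add: gen_ext_def sum_negf)

lemma gen_ext_diff: "gen_ext g (X - Y) = gen_ext g X - gen_ext g Y"
  by (simp add: gen_ext_def lmspace.scale_left_diff_distrib sum_subtractf)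

lemma gen_ext_axis: "gen_ext g (axis a 1) = g a"
proof -
  have "cscale (axis a 1 $ b) (g b) = (if b = a then g a else 0)" for b
    by (simp add: axis_def)
  then show ?thesis
    by (simp add: gen_ext_def)
qed

lemma gen_ext_sum: "gen_ext g (sum f A) = (\<Sum>i\<in>A. gen_ext g (f i))"
proof (induction A rule: infinite_finite_induct)
  case (insert x A)
  then show ?case by (simp add: gen_ext_add)
qed (simp_all add: gen_ext_def)

lemma gen_ext_bracket:
  assumes "\<And>a b. gen_ext g (bracket_gen a b) = rho10_gen a (g b) - rho10_gen b (g a)"
  shows "gen_ext g (bracket X Y) = rho10 X (gen_ext g Y) - rho10 Y (gen_ext g X)"
proof -
  have rho: "rho10 U (gen_ext g V) = (\<Sum>a\<in>UNIV. \<Sum>b\<in>UNIV. cscale (U $ a * V $ b) (rho10_gen a (g b)))" for U V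
  proof -
    have lin: "lin (rho10_gen a)" for a
      by (rule linI) (simp_all add: rho10_gen_linear)
    show ?thesis
      by (simp add: rho10_def gen_ext_def lin[THEN lmspace_pair.linear_sum] rho10_gen_linear
          lmspace.scale_sum_right)
  qed
  have "gen_ext g (bracket X Y) = (\<Sum>a\<in>UNIV. \<Sum>b\<in>UNIV. cscale (X $ a * Y $ b) (rho10_gen a (g b)))
      - (\<Sum>a\<in>UNIV. \<Sum>b\<in>UNIV. cscale (X $ a * Y $ b) (rho10_gen b (g a)))"
    by (simp add: bracket_def gen_ext_sum gen_ext_smult assms lmspace.scale_right_diff_distrib sum_subtractf)
  also have "(\<Sum>a\<in>UNIV. \<Sum>b\<in>UNIV. cscale (X $ a * Y $ b) (rho10_gen b (g a))) = rho10 Y (gen_ext g X)"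
    unfolding rho by (subst sum.swap) (simp add: mult.commute)
  finally show ?thesis
    unfolding rho .
qed

lemma so31_closed:
  assumes "X \<in> so31"
  shows "Y \<in> so31 \<Longrightarrow> X + Y \<in> so31" "r *\<^sub>R X \<in> so31"
  using assms by (simp_all add: so31_def star_def vec_eq_iff)

lemma gen_ext_cocycle:
  assumes "\<And>a. g a \<in> D10"
    and "\<And>a b. gen_ext g (bracket_gen a b) = rho10_gen a (g b) - rho10_gen b (g a)"
  shows "is_cocycle D10 rho10 (restrict (gen_ext g) so31)"
    and "cext (restrict (gen_ext g) so31) X = gen_ext g X"
proof -
  have "gen_ext g X \<in> D10" for X
    unfolding gen_ext_def using assms(1)
    by (simp add: D10_def lmspace.span_sum lmspace.span_scale)
  moreover have "gen_ext g (r *\<^sub>R X) = cscale (of_real r) (gen_ext g X)" for r X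
  proof -
    have "r *\<^sub>R X = of_real r *s X"
      unfolding vec_eq_iff vector_scaleR_component by (simp add: scaleR_conv_of_real)
    then show ?thesis
      by (simp only: gen_ext_smult)
  qed
  ultimately show "is_cocycle D10 rho10 (restrict (gen_ext g) so31)"
    using gen_ext_bracket[OF assms(2)]
    by (simp add: is_cocycle_def so31_closed bracket_so31 gen_ext_add)
  have "(1 / 2) *s (X - star X) \<in> so31" "(- \<i> / 2) *s (X + star X) \<in> so31"
    by (simp_all add: so31_def star_def vec_eq_iff field_simps)
  then have "cext (restrict (gen_ext g) so31) X =
      gen_ext g ((1 / 2) *s (X - star X) + \<i> *s ((- \<i> / 2) *s (X + star X)))"
    by (simp only: cext_def restrict_apply if_True gen_ext_add gen_ext_smult[of g \<i>])
  also have "(1 / 2) *s (X - star X) + \<i> *s ((- \<i> / 2) *s (X + star X)) = X"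
    by (simp add: vec_eq_iff field_simps)
  finally show "cext (restrict (gen_ext g) so31) X = gen_ext g X" .
qed

text \<open>In ladder form: \<open>F\<^sub>+\<close>, \<open>F\<^sub>3\<close>, \<open>F\<^sub>-\<close> are sent to \<open>xi 1 1\<close>, \<open>- xi 1 0 / \<surd>2\<close>, \<open>- xi 1 (- 1)\<close>. The first
  value is prescribed; it forces the others through \<open>2 F\<^sub>3 = [F\<^sub>+, H\<^sub>-]\<close> and \<open>F\<^sub>- = - [F\<^sub>3, H\<^sub>-]\<close>, on
  which a cocycle vanishing on \<open>H\<^sub>-\<close> takes the values \<open>- H\<^sub>- c(F\<^sub>+)\<close> and \<open>H\<^sub>- c(F\<^sub>3)\<close>.\<close>

fun c10_gen :: "gen \<Rightarrow> lmspace" where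
  "c10_gen (IH j) = 0"
| "c10_gen (IF j) =
     (if j = 1 then cscale (1 / 2) (xi 1 1 - xi 1 (- 1))
      else if j = 2 then cscale (1 / (2 * \<i>)) (xi 1 1 + xi 1 (- 1))
      else cscale (- 1 / rt 2) (xi 1 0))"

lemma c10_gen_in_D10: "c10_gen a \<in> D10"
  by (cases a) (simp_all add: D10_closed xi_in_D10)

lemma C10_1: "C10 1 = 0"
  by (simp add: C10_def)

lemma level_one_action:
  "rho10_H3 (xi 1 1) = xi 1 1" "rho10_H3 (xi 1 0) = 0" "rho10_H3 (xi 1 (- 1)) = - xi 1 (- 1)"
  "rho10_Hp (xi 1 1) = 0" "rho10_Hp (xi 1 0) = cscale (rt 2) (xi 1 1)"
  "rho10_Hp (xi 1 (- 1)) = cscale (rt 2) (xi 1 0)"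
  "rho10_Hm (xi 1 1) = cscale (rt 2) (xi 1 0)" "rho10_Hm (xi 1 0) = cscale (rt 2) (xi 1 (- 1))"
  "rho10_Hm (xi 1 (- 1)) = 0"
  "rho10_F3 (xi 1 1) = - cscale (C10 2 * rt 3) (xi 2 1)"
  "rho10_F3 (xi 1 0) = - cscale (C10 2 * 2) (xi 2 0)"
  "rho10_F3 (xi 1 (- 1)) = - cscale (C10 2 * rt 3) (xi 2 (- 1))"
  "rho10_Fp (xi 1 1) = cscale (C10 2 * rt 12) (xi 2 2)"
  "rho10_Fp (xi 1 0) = cscale (C10 2 * (rt 2 * rt 3)) (xi 2 1)"
  "rho10_Fp (xi 1 (- 1)) = cscale (C10 2 * rt 2) (xi 2 0)"
  "rho10_Fm (xi 1 1) = - cscale (C10 2 * rt 2) (xi 2 0)"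
  "rho10_Fm (xi 1 0) = - cscale (C10 2 * (rt 2 * rt 3)) (xi 2 (- 1))"
  "rho10_Fm (xi 1 (- 1)) = - cscale (C10 2 * rt 12) (xi 2 (- 2))"
  unfolding rho10_xi C10_1
  by (simp_all add: numeral_2_eq_2[symmetric] of_real_mult[symmetric] real_sqrt_mult[symmetric]
      del: of_real_mult)

lemma half_rt_2: "rt 2 / 2 = 1 / rt 2" "z * rt 2 / 2 = z / rt 2"
proof -
  have "rt 2 * rt 2 = 2"
    by (simp flip: of_real_mult)
  then show "rt 2 / 2 = 1 / rt 2" "z * rt 2 / 2 = z / rt 2"
    by (simp_all add: field_simps)
qed

text \<open>The factor \<open>2\<close> on the left is the numeral of the ring structure on finitely supported families; it
  appears when the simplifier collects equal summands.\<close>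

lemma two_mult_eq_cscale: "2 * v = cscale 2 v"
  unfolding mult_2 using lmspace.scale_left_distrib[of 1 1 v] by simp

text \<open>The cocycle identity for \<open>[F\<^sub>j, H\<^sub>k]\<close>: the values at the \<open>F\<^sub>j\<close> transform like the \<open>F\<^sub>j\<close> themselves.\<close>

lemma c10_gen_equivariant:
  "gen_ext c10_gen (bracket_gen (IF j) (IH k)) = - rho10_gen (IH k) (c10_gen (IF j))"
proof -
  have F: "gen_ext c10_gen (F j) = c10_gen (IF j)" for j
    by (simp add: F_def gen_ext_axis)
  have "\<forall>j k. gen_ext c10_gen (bracket_gen (IF j) (IH k)) = - rho10_gen (IH k) (c10_gen (IF j))"
    unfolding forall_3 bracket_gen.simps gen_ext_sum gen_ext_smult F
    by (simp add: sum_3 levi_civita_def level_one_action[simplified] half_rt_2 two_mult_eq_cscale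
        lmspace.scale_right_distrib lmspace.scale_right_diff_distrib)
  then show ?thesis by blast
qed

text \<open>The cocycle identity for \<open>[F\<^sub>j, F\<^sub>k]\<close>, a combination of the \<open>H\<^sub>l\<close>, on which \<open>c\<close> vanishes. In ladder
  form it comes down to three coincidences of spin \<open>2\<close> vectors: \<open>F\<^sub>+ c(F\<^sub>-) = F\<^sub>- c(F\<^sub>+)\<close>,
  \<open>F\<^sub>+ c(F\<^sub>3) = F\<^sub>3 c(F\<^sub>+)\<close> and \<open>F\<^sub>- c(F\<^sub>3) = F\<^sub>3 c(F\<^sub>-)\<close>.\<close>

lemma c10_gen_symmetric: "rho10_gen (IF j) (c10_gen (IF k)) = rho10_gen (IF k) (c10_gen (IF j))"
proof -
  have "\<forall>j k. rho10_gen (IF j) (c10_gen (IF k)) = rho10_gen (IF k) (c10_gen (IF j))"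
    unfolding forall_3
    by (simp add: level_one_action[simplified] lmspace.scale_right_distrib
        lmspace.scale_right_diff_distrib)
  then show ?thesis by blast
qed

definition c10 :: "so31C \<Rightarrow> lmspace" where
  "c10 = restrict (gen_ext c10_gen) so31"

lemma c10_cocycle: "is_cocycle D10 rho10 c10"
  and cext_c10: "cext c10 X = gen_ext c10_gen X"
proof -
  have zero: "rho10_gen a 0 = 0" for a
    using rho10_gen_linear(2)[of a 0 0] by simp
  have HH: "gen_ext c10_gen (H j) = 0" for j
    by (simp add: H_def gen_ext_axis)
  have "gen_ext c10_gen (bracket_gen a b) = rho10_gen a (c10_gen b) - rho10_gen b (c10_gen a)" for a b
  proof (cases a; cases b)
    fix j k assume "a = IF j" "b = IH k"
    then show ?thesis using c10_gen_equivariant[of j k] zero by simp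
  next
    fix j k assume ab: "a = IH j" "b = IF k"
    have "gen_ext c10_gen (bracket_gen a b) = - gen_ext c10_gen (bracket_gen b a)"
      by (simp only: bracket_gen_swap[of a b] gen_ext_minus)
    then show ?thesis
      unfolding ab c10_gen_equivariant by (simp add: zero del: rho10_gen.simps)
  next
    fix j k assume "a = IF j" "b = IF k"
    then show ?thesis using c10_gen_symmetric[of j k]
      by (simp add: gen_ext_sum gen_ext_smult gen_ext_minus HH del: c10_gen.simps rho10_gen.simps)
  next
    fix j k assume "a = IH j" "b = IH k"
    then show ?thesis using zero
      by (simp add: gen_ext_sum gen_ext_smult HH del: rho10_gen.simps)
  qed
  from gen_ext_cocycle[OF c10_gen_in_D10 this]
  show "is_cocycle D10 rho10 c10" "cext c10 X = gen_ext c10_gen X"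
    unfolding c10_def by blast+
qed

lemma c10_ladder:
  "cext c10 (H 3) = 0" "cext c10 H_plus = 0" "cext c10 H_minus = 0" "cext c10 F_plus = xi 1 1"
proof -
  have gens: "gen_ext c10_gen (H j) = 0" "gen_ext c10_gen (F j) = c10_gen (IF j)" for j
    by (simp_all add: H_def F_def gen_ext_axis)
  show "cext c10 (H 3) = 0" "cext c10 H_plus = 0" "cext c10 H_minus = 0"
    by (simp_all add: cext_c10 H_plus_def H_minus_def gen_ext_diff gen_ext_add gen_ext_smult gens)
  have half: "cscale (1 / 2) (u - w) + cscale \<i> (cscale (1 / (2 * \<i>)) (u + w)) = u" for u w
    by (rule poly_mapping_eqI) (simp only: lookup_add lookup_minus lookup_cscale, simp add: field_simps)
  show "cext c10 F_plus = xi 1 1"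
    unfolding cext_c10 F_plus_def gen_ext_add gen_ext_smult gens
    using half[of "xi 1 1" "xi 1 (- 1)"] by (simp del: lmspace.scale_scale)
qed

lemma c10_not_coboundary: "\<not> is_coboundary D10 rho10 c10"
proof
  assume "is_coboundary D10 rho10 c10"
  then obtain v where v: "v \<in> D10" "\<And>X. X \<in> so31 \<Longrightarrow> c10 X = rho10 X v"
    by (auto simp: is_coboundary_def)
  have cext: "cext c10 X = rho10 X v" for X
  proof -
    obtain A B where "A \<in> so31" "B \<in> so31" "X = A + \<i> *s B" by (rule so31C_decompose)
    then show ?thesis
      by (simp add: cext_add[OF c10_cocycle] cext_scale[OF c10_cocycle] cext_so31[OF c10_cocycle]
          v(2) rho10_add rho10_smult)
  qed
  have "rho10_H3 v = 0" "rho10_Hp v = 0"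
    by (simp_all only: rho10_H_3[symmetric] rho10_H_plus[symmetric] cext[symmetric] c10_ladder)
  then have "v = 0"
    by (rule no_invariants[OF v(1)])
  then have "xi 1 1 = 0"
    by (metis cext c10_ladder(4) rho10_lin(3))
  then show False
    using lookup_xi[of 1 1 "(1, 1)"] by simp
qed

lemma cocycle_diff:
  fixes a :: complex
  assumes "is_cocycle D10 rho10 \<eta>" "is_cocycle D10 rho10 \<theta>"
  defines "\<beta> \<equiv> \<lambda>X\<in>so31. \<eta> X - cscale a (\<theta> X)"
  shows "is_cocycle D10 rho10 \<beta>" "cext \<beta> X = cext \<eta> X - cscale a (cext \<theta> X)"
proof -
  note cocycles = assms(1,2)[unfolded is_cocycle_def]
  show "is_cocycle D10 rho10 \<beta>"
    unfolding is_cocycle_def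
  proof (intro conjI ballI allI)
    show "\<beta> \<in> so31 \<rightarrow>\<^sub>E D10"
      using cocycles by (auto simp: \<beta>_def intro!: D10_closed)
    fix X Y :: so31C and r :: real
    assume X: "X \<in> so31"
    show "\<beta> (r *\<^sub>R X) = cscale (of_real r) (\<beta> X)"
      using cocycles X by (simp add: \<beta>_def so31_closed lmspace.scale_right_diff_distrib mult.commute)
    assume Y: "Y \<in> so31"
    show "\<beta> (X + Y) = \<beta> X + \<beta> Y"
      using cocycles X Y by (simp add: \<beta>_def so31_closed lmspace.scale_right_distrib)
    show "\<beta> (bracket X Y) = rho10 X (\<beta> Y) - rho10 Y (\<beta> X)"
      using cocycles X Y
      by (simp add: \<beta>_def bracket_so31 lmspace.scale_right_diff_distrib
          lin_rho10[THEN lmspace_pair.linear_diff])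
  qed
  have "(1 / 2) *s (X - star X) \<in> so31" "(- \<i> / 2) *s (X + star X) \<in> so31"
    by (simp_all add: so31_def star_def vec_eq_iff field_simps)
  then show "cext \<beta> X = cext \<eta> X - cscale a (cext \<theta> X)"
    unfolding cext_def
    by (simp add: \<beta>_def lmspace.scale_right_diff_distrib lmspace.scale_right_distrib mult.commute
        del: vector_smult_lneg)
qed

theorem proposition2p4:
  shows "\<exists>c. is_cocycle D10 rho10 c \<and> cext c F_plus = xi 1 1 \<and>
    \<not> is_coboundary D10 rho10 c \<and>
    (\<forall>\<eta>. is_cocycle D10 rho10 \<eta> \<and> \<not> is_coboundary D10 rho10 \<eta> \<and> \<eta> \<noteq> c \<longrightarrow>
      (\<exists>a b \<beta>. is_coboundary D10 rho10 \<beta> \<and>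
        \<eta> = (\<lambda>X\<in>so31. cscale a (c X) + cscale b (\<beta> X))))"
proof (intro exI[of _ c10] conjI c10_cocycle c10_ladder(4) c10_not_coboundary allI impI, elim conjE)
  fix \<eta> assume \<eta>: "is_cocycle D10 rho10 \<eta>"
  obtain v a where v: "v \<in> D10" and normal: "cext \<eta> (H 3) = rho10_H3 v" "cext \<eta> H_plus = rho10_Hp v"
    "cext \<eta> H_minus = rho10_Hm v" "cext \<eta> F_plus = rho10_Fp v + cscale a (xi 1 1)"
    by (rule cocycle_normal_form[OF \<eta>])
  define \<beta> where "\<beta> = (\<lambda>X\<in>so31. \<eta> X - cscale a (c10 X))"
  note \<beta> = cocycle_diff[OF \<eta> c10_cocycle, of a, folded \<beta>_def]
  have "is_coboundary D10 rho10 \<beta>"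
    by (rule cocycle_is_coboundary[OF \<beta>(1) v]) (simp_all add: \<beta>(2) normal c10_ladder)
  moreover have "\<eta> = (\<lambda>X\<in>so31. cscale a (c10 X) + cscale 1 (\<beta> X))"
  proof
    fix X
    have "\<eta> X = undefined" if "X \<notin> so31"
      using \<eta> that by (auto simp: is_cocycle_def)
    then show "\<eta> X = (\<lambda>X\<in>so31. cscale a (c10 X) + cscale 1 (\<beta> X)) X"
      by (simp add: \<beta>_def)
  qed
  ultimately show "\<exists>a b \<beta>. is_coboundary D10 rho10 \<beta> \<and>
      \<eta> = (\<lambda>X\<in>so31. cscale a (c10 X) + cscale b (\<beta> X))"
    by blast
qed

end
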